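(* For any finite, simple, connected, undirected graphs $G$ and $H$, $$\gamma(G\square H)\geq \left(\left\lfloor\frac{d(G)}{3}\right\rfloor+1\right)\gamma(H),$$ where $d(G)$ denotes the diameter of $G$.
   Context: The distance between two vertices is the number of edges in a shortest path between them; the eccentricity $\varepsilon(v)$ of a vertex $v$ is the greatest distance from $v$ to any other vertex; the diameter is $d(G)=\max_{v\in V(G)}\varepsilon(v)$. The domination number $\gamma(G)$ is the minimum cardinality of a set $S\subseteq V(G)$ such that every vertex of $G$ lies in $S$ or is adjacent to a vertex of $S$. The Cartesian product $G\square H$ has vertex set $V(G)\times V(H)$, with $(u_1,v_1)$ and $(u_2,v_2)$ adjacent if and only if either $v_1=v_2$ and $u_1u_2\in E(G)$, or $u_1=u_2$ and $v_1v_2\in E(H)$. *)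

theory Defs
  imports "Graph_Theory.Graph_Theory"
begin

text \<open>
  A finite simple undirected graph is a \<open>pair_graph\<close>: a finite, loop-free, symmetric digraph whose
  arcs are pairs of vertices, so that an edge \<open>uv\<close> is represented by the two arcs \<open>(u, v)\<close> and
  \<open>(v, u)\<close>. Connectedness is the library's \<open>connected\<close>, which includes that there is at least one
  vertex.
\<close>

definition graph_dist :: "'a pair_pre_digraph \<Rightarrow> 'a \<Rightarrow> 'a \<Rightarrow> nat" where
  "graph_dist G u v = (LEAST n. \<exists>p. pre_digraph.apath (with_proj G) u p v \<and> length p = n)"

text \<open>
  The maximum below includes \<open>v\<close> itself, at distance 0; this only matters for the one-vertex
  graph, whose eccentricity and diameter are thereby 0.
\<close>

definition eccentricity :: "'a pair_pre_digraph \<Rightarrow> 'a \<Rightarrow> nat" where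
  "eccentricity G v = Max (graph_dist G v ` pverts G)"

definition graph_diameter :: "'a pair_pre_digraph \<Rightarrow> nat" where
  "graph_diameter G = Max (eccentricity G ` pverts G)"

definition dominating_set :: "'a pair_pre_digraph \<Rightarrow> 'a set \<Rightarrow> bool" where
  "dominating_set G S \<longleftrightarrow>
     S \<subseteq> pverts G \<and> (\<forall>v \<in> pverts G. v \<in> S \<or> (\<exists>u \<in> S. (u, v) \<in> parcs G))"

definition domination_number :: "'a pair_pre_digraph \<Rightarrow> nat" where
  "domination_number G = Min (card ` {S. dominating_set G S})"

definition cartesian_product ::
  "'a pair_pre_digraph \<Rightarrow> 'b pair_pre_digraph \<Rightarrow> ('a \<times> 'b) pair_pre_digraph" where
  "cartesian_product G H =
     \<lparr> pverts = pverts G \<times> pverts H,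
       parcs = {((u1, v1), (u2, v2)) | u1 v1 u2 v2.
         v1 = v2 \<and> v1 \<in> pverts H \<and> (u1, u2) \<in> parcs G \<or>
         u1 = u2 \<and> u1 \<in> pverts G \<and> (v1, v2) \<in> parcs H} \<rparr>"

lemma pair_graph_cartesian_product:
  assumes "pair_graph G" and "pair_graph H"
  shows "pair_graph (cartesian_product G H)"
proof -
  interpret G: pair_graph G by fact
  interpret H: pair_graph H by fact
  let ?P = "cartesian_product G H"
  have wf: "parcs ?P \<subseteq> pverts ?P \<times> pverts ?P"
    by (auto simp: cartesian_product_def dest: G.wellformed' H.wellformed')
  have fin: "finite (pverts ?P)"
    by (simp add: cartesian_product_def G.pair_finite_verts H.pair_finite_verts)
  have "finite (parcs ?P)"
    using wf fin by (meson finite_SigmaI finite_subset)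
  moreover have "sym (parcs ?P)"
    using G.pair_sym_arcs H.pair_sym_arcs
    by (auto simp: cartesian_product_def symmetric_def sym_def)
  moreover have "\<And>e. e \<in> parcs ?P \<Longrightarrow> fst e \<noteq> snd e"
    by (auto simp: cartesian_product_def dest: G.no_loops' H.no_loops')
  ultimately show ?thesis
    using wf fin by unfold_locales (auto simp: symmetric_def)
qed

end

theory Submission
  imports Defs
begin

text \<open>
  The vertices at distances \<open>0, 3, 6, \<dots>\<close> from an end of a diametral pair of \<open>G\<close> have pairwise
  disjoint closed neighbourhoods. If \<open>x\<close> is one of them, then the copy \<open>{x} \<times> H\<close> is dominated only
  from inside \<open>N[x] \<times> H\<close>, and projecting that part of a dominating set of the product to \<open>H\<close> gives
  a dominating set of \<open>H\<close>. Hence each of the \<open>\<lfloor>d(G)/3\<rfloor> + 1\<close> disjoint strips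
  \<open>N[x] \<times> H\<close> contains at least \<open>\<gamma>(H)\<close> elements of the dominating set.
\<close>

text \<open>Arcs into \<open>x\<close> are taken, matching \<open>dominating_set\<close>, where
  \<open>u\<close> dominates \<open>v\<close> through an arc from \<open>u\<close> to
  \<open>v\<close>.\<close>

definition closed_nbhd :: "'a pair_pre_digraph \<Rightarrow> 'a \<Rightarrow> 'a set" where
  "closed_nbhd G x = insert x {u. (u, x) \<in> parcs G}"

text \<open>Cutting cycles out of a walk only shortens it. This lets \<open>graph_dist\<close>, a
  minimum over paths, be bounded by walks, which can be concatenated freely.\<close>

lemma (in wf_digraph) awalk_imp_shorter_apath:
  assumes "awalk u p v"
  shows "\<exists>q. apath u q v \<and> length q \<le> length p"
  using assms
proof (induct rule: awalk_to_apath_induct)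
  case (path p)
  then show ?case by (auto simp: apath_def)
next
  case (decomp p q r s)
  then have "p = q @ r @ s"
    using awalk_cyc_decomp_has_prop[of u p v] by auto
  then show ?case using decomp by auto
qed

context pair_wf_digraph
begin

lemma graph_dist_le:
  assumes "awalk u p v"
  shows "graph_dist G u v \<le> length p"
proof -
  obtain q where "apath u q v" "length q \<le> length p"
    using awalk_imp_shorter_apath[OF assms] by auto
  then show ?thesis
    unfolding graph_dist_def by (intro order_trans[OF Least_le]) auto
qed

lemma graph_dist_self:
  assumes "u \<in> pverts G"
  shows "graph_dist G u u = 0"
proof -
  have "awalk u [] u" using assms by (simp only: awalk_Nil_iff)
  from graph_dist_le[OF this] show ?thesis by simp
qed

text \<open>Reachability guarantees that some path exists, so the \<open>LEAST\<close> in
  \<open>graph_dist\<close> is attained.\<close>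

lemma ex_awalk_graph_dist:
  assumes "u \<rightarrow>\<^sup>*\<^bsub>with_proj G\<^esub> v"
  shows "\<exists>p. awalk u p v \<and> length p = graph_dist G u v"
proof -
  obtain p where "apath u p v"
    using assms unfolding reachable_apath by (rule exE)
  then have "\<exists>n p. apath u p v \<and> length p = n" by blast
  then have "\<exists>p. apath u p v \<and> length p = graph_dist G u v"
    unfolding graph_dist_def by (rule LeastI_ex)
  then show ?thesis unfolding apath_def by blast
qed

lemma graph_dist_arc:
  assumes "a \<rightarrow>\<^sup>*\<^bsub>with_proj G\<^esub> v" and "(v, w) \<in> parcs G"
  shows "graph_dist G a w \<le> Suc (graph_dist G a v)"
proof -
  obtain p where p: "awalk a p v" "length p = graph_dist G a v"
    using ex_awalk_graph_dist[OF assms(1)] by blast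
  moreover have "awalk v [(v, w)] w"
    using arc_implies_awalk[OF assms(2)] by simp
  ultimately have "awalk a (p @ [(v, w)]) w" by (blast intro: awalk_appendI)
  from graph_dist_le[OF this] show ?thesis by (simp add: p(2))
qed

text \<open>A discrete intermediate value argument: along a walk from \<open>a\<close> the distance
  from \<open>a\<close> starts at 0 and rises by at most one per arc, so it skips no value.\<close>

lemma ex_vertex_at_dist:
  assumes "a \<rightarrow>\<^sup>*\<^bsub>with_proj G\<^esub> b" and "k \<le> graph_dist G a b"
  shows "\<exists>x. a \<rightarrow>\<^sup>*\<^bsub>with_proj G\<^esub> x \<and> graph_dist G a x = k"
  using assms
proof (induct rule: reachable_induct)
  case base
  then show ?case using graph_dist_self by auto
next
  case (step v w)
  have w: "a \<rightarrow>\<^sup>*\<^bsub>with_proj G\<^esub> w"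
    using step(1,2) by (rule reachable_adj_trans)
  have "graph_dist G a w \<le> Suc (graph_dist G a v)"
    using step(1,2) by (rule graph_dist_arc)
  \<comment> \<open>If \<open>k\<close> exceeds the distance to \<open>v\<close>, it is squeezed
    between the distance to \<open>w\<close> and that to \<open>v\<close> plus one.\<close>
  then consider "k \<le> graph_dist G a v" | "k = graph_dist G a w"
    using step(4) by linarith
  then show ?case using step(3) w by cases auto
qed

end

lemma dominating_set_pverts: "dominating_set G (pverts G)"
  by (simp add: dominating_set_def)

lemma finite_dominating_sets:
  assumes "finite (pverts G)"
  shows "finite {S. dominating_set G S}"
  by (rule finite_subset[of _ "Pow (pverts G)"]) (auto simp: dominating_set_def assms)

lemma domination_number_le:
  assumes "finite (pverts G)" and "dominating_set G S"
  shows "domination_number G \<le> card S"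
  unfolding domination_number_def
  using assms by (intro Min_le) (auto simp: finite_dominating_sets)

lemma ex_minimum_dominating_set:
  assumes "finite (pverts G)"
  shows "\<exists>S. dominating_set G S \<and> card S = domination_number G"
proof -
  have "domination_number G \<in> card ` {S. dominating_set G S}"
    unfolding domination_number_def
    using finite_dominating_sets[OF assms] dominating_set_pverts by (intro Min_in) auto
  then show ?thesis by auto
qed

lemma card_dominating_set_strip:
  assumes fin: "finite S" "finite (pverts H)"
    and dom: "dominating_set (cartesian_product G H) S"
    and x: "x \<in> pverts G"
  shows "domination_number H \<le> card (S \<inter> closed_nbhd G x \<times> UNIV)"
proof -
  let ?T = "S \<inter> closed_nbhd G x \<times> UNIV"
  have "dominating_set H (snd ` ?T)"
    unfolding dominating_set_def
  proof (intro conjI ballI)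
    show "snd ` ?T \<subseteq> pverts H"
      using dom by (auto simp: dominating_set_def cartesian_product_def)
  next
    fix h assume "h \<in> pverts H"
    then have "(x, h) \<in> S \<or> (\<exists>s\<in>S. (s, (x, h)) \<in> parcs (cartesian_product G H))"
      using dom x by (auto simp: dominating_set_def cartesian_product_def)
    \<comment> \<open>An arc of the product into \<open>(x, h)\<close> either keeps \<open>h\<close>
      and starts over a neighbour of \<open>x\<close>, so \<open>h\<close> itself is projected, or
      keeps \<open>x\<close> and projects to an arc of \<open>H\<close> into
      \<open>h\<close>.\<close>
    then show "h \<in> snd ` ?T \<or> (\<exists>u\<in>snd ` ?T. (u, h) \<in> parcs H)"
      by (force simp: cartesian_product_def closed_nbhd_def)
  qed
  then have "domination_number H \<le> card (snd ` ?T)"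
    using domination_number_le fin(2) by blast
  also have "\<dots> \<le> card ?T"
    using fin(1) by (intro card_image_le) auto
  finally show ?thesis .
qed

text \<open>Strips over disjoint closed neighbourhoods cut disjoint pieces out of one minimum
  dominating set of the product, so the bounds for single strips add up.\<close>

lemma packing_mult_domination_number_le:
  assumes fin: "finite (pverts G)" "finite (pverts H)"
    and I: "finite I" "\<And>i. i \<in> I \<Longrightarrow> x i \<in> pverts G"
    and disj: "disjoint_family_on (\<lambda>i. closed_nbhd G (x i)) I"
  shows "card I * domination_number H \<le> domination_number (cartesian_product G H)"
proof -
  have finP: "finite (pverts (cartesian_product G H))"
    using fin by (simp add: cartesian_product_def)
  obtain S where S: "dominating_set (cartesian_product G H) S"
      "card S = domination_number (cartesian_product G H)"
    using ex_minimum_dominating_set[OF finP] by auto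
  have finS: "finite S"
    using S(1) finP by (auto simp: dominating_set_def intro: finite_subset)
  let ?T = "\<lambda>i. S \<inter> closed_nbhd G (x i) \<times> UNIV"
  have "card I * domination_number H = (\<Sum>i\<in>I. domination_number H)"
    by simp
  also have "\<dots> \<le> (\<Sum>i\<in>I. card (?T i))"
    using card_dominating_set_strip[OF finS fin(2) S(1)] I(2) by (intro sum_mono) auto
  also have "\<dots> = card (\<Union>i\<in>I. ?T i)"
    using I(1) finS disj by (intro card_UN_disjoint[symmetric]) (auto simp: disjoint_family_on_def)
  also have "\<dots> \<le> card S"
    using finS by (intro card_mono) auto
  finally show ?thesis using S(2) by simp
qed

lemma (in pair_graph) ex_diametral_pair:
  assumes "pverts G \<noteq> {}"
  shows "\<exists>a\<in>pverts G. \<exists>b\<in>pverts G. graph_dist G a b = graph_diameter G"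
proof -
  have "graph_diameter G \<in> eccentricity G ` pverts G"
    unfolding graph_diameter_def using assms pair_finite_verts by (intro Max_in) auto
  moreover have "eccentricity G a \<in> graph_dist G a ` pverts G" for a
    unfolding eccentricity_def using assms pair_finite_verts by (intro Max_in) auto
  ultimately show ?thesis by (metis imageE)
qed

text \<open>The closed neighbourhood of a vertex at distance 3i from an end \<open>a\<close> of a
  diametral pair only meets distances from 3i - 1 to 3i + 1, and these windows are disjoint for
  different i.\<close>

lemma (in pair_graph) ex_distance_packing:
  assumes "connected (with_proj G)"
  shows "\<exists>x. (\<forall>i\<in>{..graph_diameter G div 3}. x i \<in> pverts G) \<and>
    disjoint_family_on (\<lambda>i. closed_nbhd G (x i)) {..graph_diameter G div 3}"
proof -
  have "strongly_connected (with_proj G)"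
    using sym_arcs assms by (rule symmetric_connected_imp_strongly_connected)
  then have ne: "pverts G \<noteq> {}"
    and reach: "\<And>u v. u \<in> pverts G \<Longrightarrow> v \<in> pverts G \<Longrightarrow> u \<rightarrow>\<^sup>*\<^bsub>with_proj G\<^esub> v"
    by (auto simp: strongly_connected_def)
  obtain a b where ab: "a \<in> pverts G" "b \<in> pverts G" "graph_dist G a b = graph_diameter G"
    using ex_diametral_pair[OF ne] by blast
  have "\<exists>v. v \<in> pverts G \<and> graph_dist G a v = 3 * i" if "i \<le> graph_diameter G div 3" for i
  proof -
    have "3 * i \<le> graph_dist G a b" using that ab(3) by linarith
    then show ?thesis
      using ex_vertex_at_dist[OF reach[OF ab(1,2)]] reachable_in_verts(2) by blast
  qed
  then obtain x where x: "\<And>i. i \<le> graph_diameter G div 3 \<Longrightarrow> x i \<in> pverts G"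
      "\<And>i. i \<le> graph_diameter G div 3 \<Longrightarrow> graph_dist G a (x i) = 3 * i"
    by metis
  have near: "graph_dist G a u \<le> Suc (3 * i) \<and> 3 * i \<le> Suc (graph_dist G a u)"
    if i: "i \<le> graph_diameter G div 3" and u: "u \<in> closed_nbhd G (x i)" for i u
  proof (cases "u = x i")
    case False
    then have arc: "(u, x i) \<in> parcs G" using u by (simp add: closed_nbhd_def)
    \<comment> \<open>Each orientation of the edge yields one of the two inequalities.\<close>
    then have "(x i, u) \<in> parcs G"
      using pair_sym_arcs by (auto simp: symmetric_def dest: symD)
    then show ?thesis
      using arc graph_dist_arc[OF reach[OF ab(1)]] x i wellformed'(1) by metis
  qed (use x i in auto)
  have "closed_nbhd G (x i) \<inter> closed_nbhd G (x j) = {}"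
    if "i \<le> graph_diameter G div 3" "j \<le> graph_diameter G div 3" "i \<noteq> j" for i j
  proof (rule ccontr)
    assume "closed_nbhd G (x i) \<inter> closed_nbhd G (x j) \<noteq> {}"
    then obtain u where u: "u \<in> closed_nbhd G (x i)" "u \<in> closed_nbhd G (x j)" by auto
    show False
      using near[OF that(1) u(1)] near[OF that(2) u(2)] \<open>i \<noteq> j\<close> by linarith
  qed
  with x(1) show ?thesis by (auto simp: disjoint_family_on_def intro!: exI[of _ x])
qed

theorem proposition4p3:
  fixes G :: "'a pair_pre_digraph" and H :: "'b pair_pre_digraph"
  assumes "pair_graph G" and "connected G"
    and "pair_graph H" and "connected H"
  shows "domination_number (cartesian_product G H)
    \<ge> (graph_diameter G div 3 + 1) * domination_number H"
proof -
  interpret G: pair_graph G by fact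
  interpret H: pair_graph H by fact
  obtain x where "\<forall>i\<in>{..graph_diameter G div 3}. x i \<in> pverts G"
      "disjoint_family_on (\<lambda>i. closed_nbhd G (x i)) {..graph_diameter G div 3}"
    using G.ex_distance_packing[OF assms(2)] by blast
  then show ?thesis
    \<comment> \<open>The index set starts at 0, which accounts for the summand 1 in the
      bound.\<close>
    using packing_mult_domination_number_le[OF G.pair_finite_verts H.pair_finite_verts,
        of "{..graph_diameter G div 3}" x] by simp
qed

end
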